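(* Consider an instance of the tree budgeted prize-collecting covering subgraph problem on a graph $G=(V,E)$ with edge costs $\ell_e\ge 0$ (as defined in the context). Let $T\subseteq E$ be an optimal tree and let $v,w,k\in V$ be distinct vertices visited by $T$. Suppose that the three edges $\{v,w\}$, $\{v,k\}$, $\{w,k\}$ are in $E$ and that $\{v,w\}$ is the most expensive one among them, i.e. $\ell_{\{v,w\}}\ge \ell_{\{v,k\}}$ and $\ell_{\{v,w\}}\ge \ell_{\{w,k\}}$. Then either $\{v,w\}\notin T$, or there exists another optimal tree $T'$ such that $\{v,w\}\notin T'$ and $$T\setminus\bigl\{\{v,w\},\{v,k\},\{w,k\}\bigr\}=T'\setminus\bigl\{\{v,w\},\{v,k\},\{w,k\}\bigr\}.$$
   Context: Instance. $G=(V,E)$ is a finite simple undirected graph with a distinguished vertex $0\in V$ (the depot). Given are a budget $L>0$; a cost $\ell_e\ge 0$ for each $e\in E$; for each $v\in V$ a neighbourhood $N_v\subseteq V\setminus\{v\}$ (the set of vertices that can cover $v$; it is not necessarily the graph neighbourhood); a coverage capacity $c_v$ (a nonnegative integer) for each $v\in V$; a prize $p_v\ge 0$ earned by visiting $v$, for each $v\in V$; and a prize $q_{vw}\ge 0$ earned by covering $v$ via $w$, for each $v\in V\setminus\{0\}$ and $w\in N_v$. Feasible trees. A tree is identified with its edge set $T\subseteq E$. The vertices visited by $T$ are the depot $0$ together with all endpoints of edges of $T$; let $V(T)$ denote this set. $T$ is a feasible tree if the graph $(V(T),T)$ is connected and acyclic and $\sum_{e\in T}\ell_e\le L$. Coverage.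 Given the set $V(T)$ of visited vertices, a coverage assignment assigns to some of the unvisited vertices $v\in V\setminus V(T)$ a single visited vertex $w\in N_v\cap V(T)$ (then $v$ is said to be covered by $w$), such that each visited vertex $w$ covers at most $c_w$ vertices. Each unvisited vertex is covered by at most one visited vertex, and visited vertices are not covered. Objective. The collected prize is the sum of $p_v$ over all visited vertices $v\neq 0$ plus the sum of $q_{vw}$ over all pairs such that $v$ is covered by $w$. A feasible tree $T$ is optimal if, with a best coverage assignment, its collected prize is maximum among all feasible trees and coverage assignments. *)

theory Defs
  imports Complex_Main
begin

record 'a covering_problem =
  verts :: "'a set"
  edges :: "'a set set"
  depot :: 'a
  budget :: real
  edge_cost :: "'a set \<Rightarrow> real"
  nbhd :: "'a \<Rightarrow> 'a set"
  capacity :: "'a \<Rightarrow> nat"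
  visit_prize :: "'a \<Rightarrow> real"
  cover_prize :: "'a \<Rightarrow> 'a \<Rightarrow> real"

text \<open>
  \<open>nbhd P v\<close> is the set of vertices that can cover \<open>v\<close>; it is unrelated to adjacency in the
  graph.  \<open>cover_prize P v w\<close> is the prize for covering \<open>v\<close> via \<open>w\<close>.
\<close>

locale covering_instance =
  fixes P :: "'a covering_problem"
  assumes finite_verts: "finite (verts P)"
    and simple_edges: "edges P \<subseteq> {e. e \<subseteq> verts P \<and> card e = 2}"
    and depot_in_verts: "depot P \<in> verts P"
    and budget_pos: "budget P > 0"
    and edge_cost_nonneg: "\<And>e. e \<in> edges P \<Longrightarrow> edge_cost P e \<ge> 0"
    and nbhd_subset: "\<And>v. v \<in> verts P \<Longrightarrow> nbhd P v \<subseteq> verts P - {v}"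
    and visit_prize_nonneg: "\<And>v. v \<in> verts P \<Longrightarrow> visit_prize P v \<ge> 0"
    and cover_prize_nonneg:
      "\<And>v w. v \<in> verts P - {depot P} \<Longrightarrow> w \<in> nbhd P v \<Longrightarrow> cover_prize P v w \<ge> 0"

text \<open>The depot counts as visited even by the empty tree.\<close>

definition visited :: "'a covering_problem \<Rightarrow> 'a set set \<Rightarrow> 'a set" where
  "visited P T = insert (depot P) (\<Union>T)"

definition connected_graph :: "'a set \<Rightarrow> 'a set set \<Rightarrow> bool" where
  "connected_graph U T \<longleftrightarrow> (\<forall>x\<in>U. \<forall>y\<in>U. (x, y) \<in> {(a, b). {a, b} \<in> T}\<^sup>*)"

text \<open>A cycle is given by the cyclic sequence of its at least three distinct vertices.\<close>

definition is_cycle :: "'a set set \<Rightarrow> 'a list \<Rightarrow> bool" where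
  "is_cycle T xs \<longleftrightarrow> length xs \<ge> 3 \<and> distinct xs \<and>
     (\<forall>i < length xs. {xs ! i, xs ! (Suc i mod length xs)} \<in> T)"

definition acyclic_graph :: "'a set set \<Rightarrow> bool" where
  "acyclic_graph T \<longleftrightarrow> (\<nexists>xs. is_cycle T xs)"

definition feasible_tree :: "'a covering_problem \<Rightarrow> 'a set set \<Rightarrow> bool" where
  "feasible_tree P T \<longleftrightarrow> T \<subseteq> edges P \<and> connected_graph (visited P T) T \<and> acyclic_graph T \<and>
     (\<Sum>e\<in>T. edge_cost P e) \<le> budget P"

text \<open>\<open>f v = Some w\<close> means that \<open>v\<close> is covered by \<open>w\<close>, and \<open>f v = None\<close> that \<open>v\<close> is not covered.\<close>

definition coverage_assignment :: "'a covering_problem \<Rightarrow> 'a set set \<Rightarrow> ('a \<rightharpoonup> 'a) \<Rightarrow> bool" where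
  "coverage_assignment P T f \<longleftrightarrow> dom f \<subseteq> verts P - visited P T \<and>
     (\<forall>v w. f v = Some w \<longrightarrow> w \<in> nbhd P v \<inter> visited P T) \<and>
     (\<forall>w\<in>visited P T. card {v. f v = Some w} \<le> capacity P w)"

definition collected_prize :: "'a covering_problem \<Rightarrow> 'a set set \<Rightarrow> ('a \<rightharpoonup> 'a) \<Rightarrow> real" where
  "collected_prize P T f =
     (\<Sum>v\<in>visited P T - {depot P}. visit_prize P v) + (\<Sum>v\<in>dom f. cover_prize P v (the (f v)))"

definition optimal_tree :: "'a covering_problem \<Rightarrow> 'a set set \<Rightarrow> bool" where
  "optimal_tree P T \<longleftrightarrow> feasible_tree P T \<and>
     (\<exists>f. coverage_assignment P T f \<and>
       (\<forall>T' f'. feasible_tree P T' \<and> coverage_assignment P T' f' \<longrightarrow>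
          collected_prize P T' f' \<le> collected_prize P T f))"

end

theory Submission
  imports Defs
begin

text \<open>
  Removing \<open>{v, w}\<close> splits the tree into the part containing \<open>v\<close> and the part containing \<open>w\<close>,
  and \<open>k\<close> lies in one of them.  Say it lies with \<open>v\<close>; then \<open>{w, k}\<close> joins the two parts again
  and is no more expensive than \<open>{v, w}\<close>, so the exchange yields a tree within the budget.  The
  exchange visits the same vertices: \<open>w\<close> and \<open>k\<close> are on the new edge, and \<open>v\<close> is still on an edge
  of its part because that part also contains \<open>k \<noteq> v\<close>.  Coverage assignments and prizes
  depend on a tree only through its visited vertices, so the new tree is optimal too.  If \<open>k\<close> lies
  with \<open>w\<close>, the same argument applies with \<open>v\<close> and \<open>w\<close> interchanged.

  The graph theory behind this is that an edge of an acyclic graph is the only connection between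
  its ends (\<open>acyclic_edge_is_bridge\<close>), and that an edge between two disconnected vertices closes
  no cycle (\<open>acyclic_insert_bridge\<close>).  They are combined in \<open>exchange_spanning\<close>, while
  \<open>optimal_tree_transfer\<close> reduces optimality to feasibility and the visited vertices.
\<close>

section \<open>Reachability in graphs given by edge sets\<close>

abbreviation adj :: "'a set set \<Rightarrow> ('a \<times> 'a) set" where
  "adj T \<equiv> {(a, b). {a, b} \<in> T}"

lemma sym_adj_rtrancl: "(x, y) \<in> (adj T)\<^sup>* \<Longrightarrow> (y, x) \<in> (adj T)\<^sup>*"
proof -
  have "sym (adj T)"
    by (auto simp: sym_def insert_commute)
  then show "(x, y) \<in> (adj T)\<^sup>* \<Longrightarrow> (y, x) \<in> (adj T)\<^sup>*"
    by (meson sym_rtrancl symD)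
qed

lemma rtrancl_imp_simple_path:
  assumes "(a, b) \<in> R\<^sup>*"
  shows "\<exists>xs. xs \<noteq> [] \<and> hd xs = a \<and> last xs = b \<and> distinct xs \<and>
           successively (\<lambda>x y. (x, y) \<in> R) xs"
  using assms
proof (induction rule: converse_rtrancl_induct)
  case base
  show ?case by (rule exI[of _ "[b]"]) simp
next
  case (step a c)
  then obtain xs where xs: "xs \<noteq> []" "hd xs = c" "last xs = b" "distinct xs"
      "successively (\<lambda>x y. (x, y) \<in> R) xs"
    by blast
  show ?case
  proof (cases "a \<in> set xs")
    case True
    \<comment> \<open>Cut off the detour: keep only the part of the path that starts at \<open>a\<close>.\<close>
    then obtain ys zs where "xs = ys @ a # zs"
      by (meson split_list)
    with xs show ?thesis
      by (intro exI[of _ "a # zs"]) (auto simp: successively_append_iff)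
  next
    case False
    with xs step.hyps(1) show ?thesis
      by (intro exI[of _ "a # xs"]) (auto simp: successively_Cons)
  qed
qed

section \<open>Cycles and bridges\<close>

text \<open>A second connection between the ends of an edge can be taken to be a simple path, and the
  edge closes it to a cycle.\<close>

lemma acyclic_edge_is_bridge:
  assumes "acyclic_graph T" and "{a, b} \<in> T" and "a \<noteq> b"
  shows "(a, b) \<notin> (adj (T - {{a, b}}))\<^sup>*"
proof
  assume path: "(a, b) \<in> (adj (T - {{a, b}}))\<^sup>*"
  obtain xs where xs: "xs \<noteq> []" "hd xs = a" "last xs = b" "distinct xs"
      "successively (\<lambda>x y. (x, y) \<in> adj (T - {{a, b}})) xs"
    using rtrancl_imp_simple_path[OF path] by blast
  from xs(1) consider x where "xs = [x]" | x y where "xs = [x, y]" | "length xs \<ge> 3"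
    by (cases xs rule: remdups_adj.cases) (auto simp: Suc_le_eq)
  then have len: "length xs \<ge> 3"
    using xs assms(3) by cases auto
  have "{xs ! i, xs ! (Suc i mod length xs)} \<in> T" if "i < length xs" for i
  proof (cases "Suc i < length xs")
    case True
    then show ?thesis
      using successively_nth[OF xs(5)] by fastforce
  next
    case False
    then have "Suc i = length xs"
      using that by linarith
    then have "i = length xs - 1" "Suc i mod length xs = 0"
      by auto
    then have "xs ! i = b" "xs ! (Suc i mod length xs) = a"
      using xs(1-3) by (auto simp: hd_conv_nth last_conv_nth)
    then show ?thesis
      using assms(2) by (simp add: insert_commute)
  qed
  then have "is_cycle T xs"
    using len xs(4) by (auto simp: is_cycle_def)
  with assms(1) show False
    by (auto simp: acyclic_graph_def)
qed

text \<open>A cycle contains each of its edges just once, so the edges other than a given one lead from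
  one end of that edge to the other.  The bound on the length matters: on two vertices, the two
  steps of the cyclic sequence would be one and the same edge.\<close>

lemma cycle_bypasses_edge:
  assumes cyc: "is_cycle T xs" and i: "i < length xs"
    and e: "e = {xs ! i, xs ! (Suc i mod length xs)}"
  shows "(xs ! (Suc i mod length xs), xs ! i) \<in> (adj (T - {e}))\<^sup>*"
proof -
  let ?n = "length xs"
  have n: "?n \<ge> 3" and dist: "distinct xs"
    and edge: "\<And>j. j < ?n \<Longrightarrow> {xs ! j, xs ! (Suc j mod ?n)} \<in> T"
    using cyc by (auto simp: is_cycle_def)
  have walk: "(xs ! (Suc i mod ?n), xs ! ((Suc i + j) mod ?n)) \<in> (adj (T - {e}))\<^sup>*"
    if "j < ?n" for j
    using that
  proof (induction j)
    case 0
    show ?case by simp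
  next
    case (Suc j)
    let ?p = "(Suc i + j) mod ?n"
    have "?n > 0"
      using n by linarith
    then have p: "?p < ?n" and q: "Suc i mod ?n < ?n" and r: "Suc ?p mod ?n < ?n"
      by (blast intro: mod_less_divisor)+
    \<comment> \<open>The step from \<open>?p\<close> could traverse \<open>e\<close> only in its own direction, one full round too late,
      or backwards, which would make the cycle close up after two steps.\<close>
    have "?p \<noteq> i"
    proof
      assume "?p = i"
      then have "(i + Suc j) mod ?n = i mod ?n"
        using i by simp
      then have "?n dvd Suc j"
        by (metis add_diff_cancel_left' le_add1 mod_eq_dvd_iff_nat)
      then show False
        using Suc.prems by (auto dest: dvd_imp_le)
    qed
    moreover have "\<not> (?p = Suc i mod ?n \<and> Suc ?p mod ?n = i)"
    proof
      assume "?p = Suc i mod ?n \<and> Suc ?p mod ?n = i"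
      then have "(i + 2) mod ?n = i mod ?n"
        using i by (metis Suc_eq_plus1 add_2_eq_Suc' mod_Suc_eq mod_less)
      then have "?n dvd 2"
        by (metis add_diff_cancel_left' le_add1 mod_eq_dvd_iff_nat)
      then show False
        using n by (auto dest: dvd_imp_le)
    qed
    ultimately have "{xs ! ?p, xs ! (Suc ?p mod ?n)} \<noteq> e"
      using p q r i dist by (auto simp: e doubleton_eq_iff nth_eq_iff_index_eq)
    then have "(xs ! ?p, xs ! (Suc ?p mod ?n)) \<in> adj (T - {e})"
      using edge[OF p] by simp
    moreover have "Suc ?p mod ?n = (Suc i + Suc j) mod ?n"
      by (simp add: mod_Suc_eq)
    ultimately show ?case
      using Suc by (metis (no_types, lifting) Suc_lessD rtrancl.rtrancl_into_rtrancl)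
  qed
  have "Suc i + (?n - 1) = i + ?n"
    using n by linarith
  then have "(Suc i + (?n - 1)) mod ?n = i"
    using i by simp
  then show ?thesis
    using walk[of "?n - 1"] n by simp
qed

lemma acyclic_insert_bridge:
  assumes "acyclic_graph S" and "(a, b) \<notin> (adj S)\<^sup>*"
  shows "acyclic_graph (insert {a, b} S)"
  unfolding acyclic_graph_def
proof
  assume "\<exists>xs. is_cycle (insert {a, b} S) xs"
  then obtain xs where cyc: "is_cycle (insert {a, b} S) xs"
    by blast
  have "\<not> is_cycle S xs"
    using assms(1) by (auto simp: acyclic_graph_def)
  then obtain i where i: "i < length xs" "{a, b} = {xs ! i, xs ! (Suc i mod length xs)}"
    using cyc by (fastforce simp: is_cycle_def)
  have "adj (insert {a, b} S - {{a, b}}) \<subseteq> adj S"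
    by auto
  then have "(xs ! (Suc i mod length xs), xs ! i) \<in> (adj S)\<^sup>*"
    using cycle_bypasses_edge[OF cyc i] rtrancl_mono by blast
  then have "(a, b) \<in> (adj S)\<^sup>*"
    using i(2) by (auto simp: doubleton_eq_iff dest: sym_adj_rtrancl)
  with assms(2) show False ..
qed

lemma acyclic_graph_mono:
  assumes "acyclic_graph T" and "S \<subseteq> T"
  shows "acyclic_graph S"
  using assms unfolding acyclic_graph_def is_cycle_def by blast

section \<open>Exchanging an edge of a tree\<close>

lemma reachable_after_edge_removal:
  assumes "(a, x) \<in> (adj T)\<^sup>*"
  shows "(a, x) \<in> (adj (T - {{a, b}}))\<^sup>* \<or> (b, x) \<in> (adj (T - {{a, b}}))\<^sup>*"
  using assms
proof (induction rule: rtrancl_induct)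
  case base
  show ?case by simp
next
  case (step y z)
  show ?case
  proof (cases "{y, z} = {a, b}")
    case True
    \<comment> \<open>After a step along the removed edge, the walk starts afresh at one of its ends.\<close>
    then show ?thesis
      by (auto simp: doubleton_eq_iff)
  next
    case False
    with step show ?thesis
      by (auto intro: rtrancl_into_rtrancl)
  qed
qed

text \<open>Here \<open>k\<close> lies on the side of \<open>a\<close> once \<open>{a, b}\<close> is removed, so \<open>{b, k}\<close> reconnects the two
  sides.\<close>

lemma exchange_spanning:
  assumes conn: "connected_graph U T" and acyc: "acyclic_graph T"
    and ab: "{a, b} \<in> T" "a \<noteq> b"
    and k: "(a, k) \<in> (adj (T - {{a, b}}))\<^sup>*"
  shows "connected_graph U (insert {b, k} (T - {{a, b}}))"
    and "acyclic_graph (insert {b, k} (T - {{a, b}}))"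
proof -
  let ?S = "T - {{a, b}}" and ?T' = "insert {b, k} (T - {{a, b}})"
  have sub: "(adj ?S)\<^sup>* \<subseteq> (adj ?T')\<^sup>*"
    by (rule rtrancl_mono) auto
  have "(a, k) \<in> (adj ?T')\<^sup>*"
    using k sub by blast
  moreover have "(k, b) \<in> adj ?T'"
    by (simp add: insert_commute)
  ultimately have reach: "(a, b) \<in> (adj ?T')\<^sup>*"
    by (rule rtrancl_into_rtrancl)
  have "adj T \<subseteq> (adj ?T')\<^sup>*"
  proof (rule subrelI)
    fix x y
    assume xy: "(x, y) \<in> adj T"
    show "(x, y) \<in> (adj ?T')\<^sup>*"
    proof (cases "{x, y} = {a, b}")
      case True
      then show ?thesis
        using reach sym_adj_rtrancl[OF reach] by (auto simp: doubleton_eq_iff)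
    next
      case False
      with xy show ?thesis
        by (intro r_into_rtrancl) simp
    qed
  qed
  then have "(adj T)\<^sup>* \<subseteq> (adj ?T')\<^sup>*"
    by (rule rtrancl_subset_rtrancl)
  then show "connected_graph U ?T'"
    using conn unfolding connected_graph_def by blast
  have "(b, k) \<notin> (adj ?S)\<^sup>*"
  proof
    assume "(b, k) \<in> (adj ?S)\<^sup>*"
    then have "(a, b) \<in> (adj ?S)\<^sup>*"
      by (rule rtrancl_trans[OF k sym_adj_rtrancl])
    with acyclic_edge_is_bridge[OF acyc ab] show False ..
  qed
  moreover have "acyclic_graph ?S"
    using acyc by (rule acyclic_graph_mono) auto
  ultimately show "acyclic_graph ?T'"
    by (rule acyclic_insert_bridge[rotated])
qed

lemma exchange_visited:
  assumes ab: "{a, b} \<in> T" and k: "(a, k) \<in> (adj (T - {{a, b}}))\<^sup>*"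
    and "k \<noteq> a" and "k \<in> visited P T"
  shows "visited P (insert {b, k} (T - {{a, b}})) = visited P T"
proof -
  \<comment> \<open>The vertex \<open>a\<close> stays visited, since a walk from \<open>a\<close> to \<open>k \<noteq> a\<close> has a first edge.\<close>
  obtain c where "(a, c) \<in> adj (T - {{a, b}})"
    using k \<open>k \<noteq> a\<close> by (metis converse_rtranclE)
  then have a: "a \<in> \<Union>(T - {{a, b}})"
    by auto
  have "\<Union>T = insert a (insert b (\<Union>(T - {{a, b}})))"
    using ab by blast
  then show ?thesis
    using a \<open>k \<in> visited P T\<close> unfolding visited_def by auto
qed

section \<open>Optimality of the exchanged tree\<close>

lemma optimal_tree_transfer:
  assumes "optimal_tree P T" and "feasible_tree P T'" and "visited P T' = visited P T"
  shows "optimal_tree P T'"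
  using assms unfolding optimal_tree_def coverage_assignment_def collected_prize_def by simp

lemma exchange_optimal:
  assumes inst: "covering_instance P" and opt: "optimal_tree P T"
    and ab: "{a, b} \<in> T" "a \<noteq> b"
    and k: "(a, k) \<in> (adj (T - {{a, b}}))\<^sup>*" "k \<noteq> a" "k \<in> visited P T"
    and bk: "{b, k} \<in> edges P" "edge_cost P {b, k} \<le> edge_cost P {a, b}"
  shows "optimal_tree P (insert {b, k} (T - {{a, b}}))"
proof (rule optimal_tree_transfer[OF opt])
  let ?S = "T - {{a, b}}" and ?T' = "insert {b, k} (T - {{a, b}})"
  have feas: "T \<subseteq> edges P" "connected_graph (visited P T) T" "acyclic_graph T"
      "(\<Sum>e\<in>T. edge_cost P e) \<le> budget P"
    using opt by (auto simp: optimal_tree_def feasible_tree_def)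
  show vis: "visited P ?T' = visited P T"
    using ab(1) k by (rule exchange_visited)
  have "edges P \<subseteq> Pow (verts P)" "finite (verts P)"
    using inst by (auto simp: covering_instance_def)
  then have fin: "finite T"
    using feas(1) by (meson finite_Pow_iff finite_subset)
  have "edge_cost P {b, k} \<ge> 0"
    using inst bk(1) by (auto simp: covering_instance_def)
  then have "(\<Sum>e\<in>?T'. edge_cost P e) \<le> edge_cost P {b, k} + (\<Sum>e\<in>?S. edge_cost P e)"
    using fin by (auto simp: sum.insert_if)
  also have "\<dots> \<le> edge_cost P {a, b} + (\<Sum>e\<in>?S. edge_cost P e)"
    using bk(2) by simp
  also have "\<dots> = (\<Sum>e\<in>T. edge_cost P e)"
    using fin ab(1) by (simp add: sum.remove)
  finally have "(\<Sum>e\<in>?T'. edge_cost P e) \<le> budget P"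
    using feas(4) by simp
  moreover have "?T' \<subseteq> edges P"
    using feas(1) bk(1) by auto
  ultimately show "feasible_tree P ?T'"
    using exchange_spanning[OF feas(2,3) ab k(1)] by (simp add: feasible_tree_def vis)
qed

theorem proposition4p1:
  fixes P :: "'a covering_problem" and T :: "'a set set" and v w k :: 'a
  assumes "covering_instance P"
    and "optimal_tree P T"
    and "v \<in> visited P T" and "w \<in> visited P T" and "k \<in> visited P T"
    and "v \<noteq> w" and "v \<noteq> k" and "w \<noteq> k"
    and "{v, w} \<in> edges P" and "{v, k} \<in> edges P" and "{w, k} \<in> edges P"
    and "edge_cost P {v, w} \<ge> edge_cost P {v, k}"
    and "edge_cost P {v, w} \<ge> edge_cost P {w, k}"
  shows "{v, w} \<notin> T \<or>
    (\<exists>T'. optimal_tree P T' \<and> T' \<noteq> T \<and> {v, w} \<notin> T' \<and>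
       T - {{v, w}, {v, k}, {w, k}} = T' - {{v, w}, {v, k}, {w, k}})"
proof (cases "{v, w} \<in> T")
  case False
  then show ?thesis by simp
next
  case True
  have result: ?thesis
    if opt: "optimal_tree P (insert f (T - {{v, w}}))" and f: "f = {v, k} \<or> f = {w, k}" for f
  proof -
    let ?T' = "insert f (T - {{v, w}})"
    have "{v, w} \<noteq> f"
      using f assms(6-8) by (auto simp: doubleton_eq_iff)
    then have notin: "{v, w} \<notin> ?T'"
      by simp
    moreover have "?T' \<noteq> T"
      using notin True by metis
    moreover have "T - {{v, w}, {v, k}, {w, k}} = ?T' - {{v, w}, {v, k}, {w, k}}"
      using f by auto
    ultimately show ?thesis
      using opt by (intro disjI2 exI[of _ ?T'] conjI)
  qed
  have "(v, k) \<in> (adj T)\<^sup>*"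
    using assms(2,3,5) by (auto simp: optimal_tree_def feasible_tree_def connected_graph_def)
  then consider "(v, k) \<in> (adj (T - {{v, w}}))\<^sup>*" | "(w, k) \<in> (adj (T - {{v, w}}))\<^sup>*"
    using reachable_after_edge_removal by metis
  then show ?thesis
  proof cases
    case 1
    have "optimal_tree P (insert {w, k} (T - {{v, w}}))"
      by (rule exchange_optimal[OF assms(1,2) True assms(6) 1]) (use assms in auto)
    then show ?thesis
      by (rule result) simp
  next
    case 2
    have wv: "{w, v} = {v, w}"
      by auto
    have "optimal_tree P (insert {v, k} (T - {{v, w}}))"
      by (rule exchange_optimal[where a = w and b = v, unfolded wv, OF assms(1,2) True _ 2])
        (use assms in auto)
    then show ?thesis
      by (rule result) simp
  qed
qed

end
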